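(* Let $N\ge 2$ and let $\mathscr{T}_{LR}=\mathscr{M}_l+\mathscr{A}_l+\mathscr{M}_r+\mathscr{A}_r$ be the substructured operator of the $N$-strip domain decomposition of the Helmholtz problem in left-right numbering, with $C_r=(I-\mathscr{M}_r)^{-1}\mathscr{A}_r$ and $C_l=(I-\mathscr{M}_l)^{-1}\mathscr{A}_l$. Let $M^{-1}_{BJ}:=(I-\mathscr{M}_r-\mathscr{M}_l)^{-1}$ be the Block Jacobi preconditioner for $I-\mathscr{T}_{LR}$, and let $R_{BJ}:=M_{BJ}^{-1}\bigl(M_{BJ}-(I-\mathscr{T}_{LR})\bigr)$ be its error propagation operator. Then $$R_{BJ}=C_r+C_l,$$ and for every positive even integer $n$, $$R_{BJ}^n=(C_r\,C_l)^{n/2}+(C_l\,C_r)^{n/2}.$$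
   Context: Setting. A bounded domain $\Omega\subset\mathbb{R}^2$ is decomposed into $N\ge 2$ successive strips $\Omega_1,\dots,\Omega_N$ (with or without overlap). The part of $\partial\Omega_i\setminus\partial\Omega$ on the left (right) of $\Omega_i$ is the interface $\Gamma_{i,l}$ ($\Gamma_{i,r}$); $\Gamma_{1,l}=\Gamma_{N,r}=\emptyset$. Linear interface operators $\mathcal{B}_{i,l}$ ($2\le i\le N$) and $\mathcal{B}_{i,r}$ ($1\le i\le N-1$) are given, with traces taken on $\Gamma_{i,l}$ and $\Gamma_{i,r}$. For interface functions $h_l,h_r$ and a source $f$, $S_i(h_l,h_r,f)$ denotes the solution $v$ of $(-k^2-\Delta)v=f$ in $\Omega_i$, $\mathcal{B}_{i,l}(v)=h_l$ on $\Gamma_{i,l}$ (if $i\ge2$), $\mathcal{B}_{i,r}(v)=h_r$ on $\Gamma_{i,r}$ (if $i\le N-1$), with fixed linear homogeneous boundary conditions on $\partial\Omega\cap\partial\Omega_i$; these local problems are assumed well posed, so that $S_i$ is linear (for $i=1$ the argument $h_l$ is ignored, for $i=N$ the argument $h_r$ is ignored). Substructured operator. The unknowns are interface functions ordered in the left-right (LR) numbering $(h_{2,l},h_{3,l},\dots,h_{N,l},h_{N-1,r},h_{N-2,r},\dots,h_{1,r})$, i.e. $2N-2$ components. $\mathscr{T}_{LR}$ is the $(2N-2)\times(2N-2)$ matrix of linear operators whose only possibly nonzero entries (row index first, column index second) are $\mathscr{T}_{(i+1,l)(i,l)}=\mathcal{B}_{i+1,l}(S_i(\cdot,0,0))$ for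 $2\le i\le N-1$; $\mathscr{T}_{(i+1,l)(i,r)}=\mathcal{B}_{i+1,l}(S_i(0,\cdot,0))$ for $1\le i\le N-1$; $\mathscr{T}_{(i-1,r)(i,r)}=\mathcal{B}_{i-1,r}(S_i(0,\cdot,0))$ for $2\le i\le N-1$; $\mathscr{T}_{(i-1,r)(i,l)}=\mathcal{B}_{i-1,r}(S_i(\cdot,0,0))$ for $2\le i\le N$. Submatrices. $I$ is the identity. Let $I_l$ (resp. $I_r$) be the diagonal $(2N-2)\times(2N-2)$ matrix with diagonal entries $1$ in positions $1,\dots,N-1$ (resp. $N,\dots,2N-2$) and $0$ elsewhere. Set $\mathscr{M}_l:=I_l^T\mathscr{T}_{LR}I_l$, $\mathscr{A}_l:=I_l^T\mathscr{T}_{LR}I_r$, $\mathscr{A}_r:=I_r^T\mathscr{T}_{LR}I_l$, $\mathscr{M}_r:=I_r^T\mathscr{T}_{LR}I_r$. The matrices $\mathscr{M}_l,\mathscr{M}_r$ are strictly lower triangular with $\mathscr{M}_l^{N-1}=\mathscr{M}_r^{N-1}=0$. Define $C_r:=(I-\mathscr{M}_r)^{-1}\mathscr{A}_r=\bigl(\sum_{i=0}^{N-2}\mathscr{M}_r^i\bigr)\mathscr{A}_r$ and $C_l:=(I-\mathscr{M}_l)^{-1}\mathscr{A}_l=\bigl(\sum_{i=0}^{N-2}\mathscr{M}_l^i\bigr)\mathscr{A}_l$. Error propagation operator. For a preconditioner $M^{-1}$ (with inverse $M$) of a linear operator $B$, the error propagation operator is $R:=M^{-1}(M-B)$; here $B=I-\mathscr{T}_{LR}$.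 *)

theory Defs
  imports "HOL-Analysis.Analysis" "HOL-Library.Function_Algebras"
begin

type_synonym point = "real^2"
type_synonym field = "point \<Rightarrow> complex"

text \<open>
  Functions on a set \<open>U\<close> (a subdomain or an interface) are encoded as functions on the plane
  that vanish off \<open>U\<close>.
\<close>

definition supported_on :: "point set \<Rightarrow> field \<Rightarrow> bool" where
  "supported_on U u \<longleftrightarrow> (\<forall>x. x \<notin> U \<longrightarrow> u x = 0)"

definition cscale :: "complex \<Rightarrow> field \<Rightarrow> field" where
  "cscale c u = (\<lambda>x. c * u x)"

global_interpretation cfun: vector_space cscale
  by unfold_locales (auto simp: cscale_def fun_eq_iff algebra_simps)

definition linear_into :: "field set \<Rightarrow> field set \<Rightarrow> (field \<Rightarrow> field) \<Rightarrow> bool" where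
  "linear_into U W g \<longleftrightarrow>
     (\<forall>u\<in>U. g u \<in> W) \<and>
     (\<forall>u\<in>U. \<forall>v\<in>U. g (u + v) = g u + g v) \<and>
     (\<forall>c. \<forall>u\<in>U. g (cscale c u) = cscale c (g u))"


section \<open>The Helmholtz equation in the sense of distributions\<close>

definition partial :: "2 \<Rightarrow> field \<Rightarrow> field" where
  "partial j u x = vector_derivative (\<lambda>t. u (x + t *\<^sub>R axis j 1)) (at 0)"

definition laplacian :: "field \<Rightarrow> field" where
  "laplacian u x = (\<Sum>j\<in>UNIV. partial j (partial j u) x)"

primrec Ck :: "nat \<Rightarrow> field \<Rightarrow> bool" where
  "Ck 0 u \<longleftrightarrow> continuous_on UNIV u"
| "Ck (Suc m) u \<longleftrightarrow> continuous_on UNIV u \<and>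
     (\<forall>j x. (\<lambda>t::real. u (x + t *\<^sub>R axis j 1)) differentiable at 0) \<and>
     (\<forall>j. Ck m (partial j u))"

definition test_function :: "point set \<Rightarrow> field \<Rightarrow> bool" where
  "test_function U \<phi> \<longleftrightarrow>
     (\<forall>m. Ck m \<phi>) \<and> compact (closure {x. \<phi> x \<noteq> 0}) \<and> closure {x. \<phi> x \<noteq> 0} \<subseteq> U"

definition locally_integrable :: "point set \<Rightarrow> field \<Rightarrow> bool" where
  "locally_integrable U u \<longleftrightarrow> (\<forall>K. compact K \<and> K \<subseteq> U \<longrightarrow> u absolutely_integrable_on K)"

text \<open>
  \<open>(- k\<^sup>2 - \<Delta>) v = f\<close> in \<open>U\<close>, tested against smooth functions with compact support in \<open>U\<close>; this
  covers classical as well as weak solutions.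
\<close>

definition helmholtz :: "complex \<Rightarrow> point set \<Rightarrow> field \<Rightarrow> field \<Rightarrow> bool" where
  "helmholtz k U v f \<longleftrightarrow>
     (\<forall>\<phi>. test_function U \<phi> \<longrightarrow>
        (LINT x:U|lebesgue. v x * (- (k\<^sup>2) * \<phi> x - laplacian \<phi> x)) =
        (LINT x:U|lebesgue. f x * \<phi> x))"


section \<open>Strip decompositions\<close>

datatype side = Lft | Rgt

text \<open>
  \<open>iface P i Lft\<close> and \<open>iface P i Rgt\<close> are the left and right interfaces of the subdomain
  \<open>subdom P i\<close>, for \<open>1 \<le> i \<le> nstrips P\<close>.  \<open>vol P i\<close> is the space in which the \<open>i\<close>-th local
  solution is sought, \<open>src P i\<close> the space of its sources, \<open>ifun P i s\<close> the space of interface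
  functions on \<open>iface P i s\<close>.  \<open>trop P i s\<close> is the interface operator attached to \<open>iface P i s\<close>,
  and \<open>bcop P i v = 0\<close> on \<open>frontier (dom P) \<inter> frontier (subdom P i)\<close> is the outer boundary
  condition.
\<close>

record helmholtz_dd =
  nstrips :: nat
  dom :: "point set"
  subdom :: "nat \<Rightarrow> point set"
  iface :: "nat \<Rightarrow> side \<Rightarrow> point set"
  wavenum :: complex
  vol :: "nat \<Rightarrow> field set"
  src :: "nat \<Rightarrow> field set"
  ifun :: "nat \<Rightarrow> side \<Rightarrow> field set"
  trop :: "nat \<Rightarrow> side \<Rightarrow> field \<Rightarrow> field"
  bcop :: "nat \<Rightarrow> field \<Rightarrow> field"

text \<open>
  The strips need not be straight, so the left (right) part of the inner boundary of a strip is
  identified as the part along which it meets or enters the preceding (following) strip.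
\<close>

definition strip_geometry :: "helmholtz_dd \<Rightarrow> bool" where
  "strip_geometry P \<longleftrightarrow>
     nstrips P \<ge> 2 \<and>
     open (dom P) \<and> connected (dom P) \<and> bounded (dom P) \<and> dom P \<noteq> {} \<and>
     (\<forall>i\<in>{1..nstrips P}. open (subdom P i) \<and> subdom P i \<noteq> {} \<and> subdom P i \<subseteq> dom P) \<and>
     closure (dom P) = (\<Union>i\<in>{1..nstrips P}. closure (subdom P i)) \<and>
     (\<forall>i\<in>{1..nstrips P}.
        iface P i Lft \<union> iface P i Rgt = frontier (subdom P i) - frontier (dom P) \<and>
        iface P i Lft \<inter> iface P i Rgt = {}) \<and>
     iface P 1 Lft = {} \<and> iface P (nstrips P) Rgt = {} \<and>
     (\<forall>i\<in>{2..nstrips P}. iface P i Lft \<subseteq> closure (subdom P (i - 1))) \<and>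
     (\<forall>i\<in>{1..nstrips P - 1}. iface P i Rgt \<subseteq> closure (subdom P (i + 1)))"

text \<open>
  \<open>ifun P 1 Lft\<close> and \<open>ifun P (nstrips P) Rgt\<close> consist of the zero function only, since the
  corresponding interfaces are empty.
\<close>

definition function_spaces :: "helmholtz_dd \<Rightarrow> bool" where
  "function_spaces P \<longleftrightarrow>
     (\<forall>i\<in>{1..nstrips P}.
        cfun.subspace (vol P i) \<and> cfun.subspace (src P i) \<and>
        (\<forall>u\<in>vol P i \<union> src P i. supported_on (subdom P i) u \<and> locally_integrable (subdom P i) u) \<and>
        (\<forall>s. cfun.subspace (ifun P i s) \<and> (\<forall>h\<in>ifun P i s. supported_on (iface P i s) h)))"

text \<open>
  An interface operator acts on functions on either of the two subdomains whose closure contains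
  the interface.  Linearity is required on each of the two spaces separately: without overlap
  these are the traces from the two sides.
\<close>

definition interface_operator ::
    "helmholtz_dd \<Rightarrow> nat \<Rightarrow> side \<Rightarrow> nat \<Rightarrow> bool" where
  "interface_operator P i s j \<longleftrightarrow>
     linear_into (vol P j) (ifun P i s) (trop P i s) \<and>
     (\<forall>u\<in>vol P j. \<forall>v\<in>vol P j. \<forall>U. open U \<and> iface P i s \<subseteq> U \<and> (\<forall>x\<in>U. u x = v x) \<longrightarrow>
        trop P i s u = trop P i s v)"

definition operators :: "helmholtz_dd \<Rightarrow> bool" where
  "operators P \<longleftrightarrow>
     (\<forall>i\<in>{2..nstrips P}. \<forall>j\<in>{i - 1, i}. interface_operator P i Lft j) \<and>
     (\<forall>i\<in>{1..nstrips P - 1}. \<forall>j\<in>{i, i + 1}. interface_operator P i Rgt j) \<and>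
     (\<forall>i\<in>{1..nstrips P}. linear_into (vol P i) UNIV (bcop P i))"

definition local_solution ::
    "helmholtz_dd \<Rightarrow> nat \<Rightarrow> field \<Rightarrow> field \<Rightarrow> field \<Rightarrow> field \<Rightarrow> bool" where
  "local_solution P i hl hr f v \<longleftrightarrow>
     v \<in> vol P i \<and>
     helmholtz (wavenum P) (subdom P i) v f \<and>
     (i \<ge> 2 \<longrightarrow> trop P i Lft v = hl) \<and>
     (i \<le> nstrips P - 1 \<longrightarrow> trop P i Rgt v = hr) \<and>
     (\<forall>x\<in>frontier (dom P) \<inter> frontier (subdom P i). bcop P i v x = 0)"

definition well_posed :: "helmholtz_dd \<Rightarrow> bool" where
  "well_posed P \<longleftrightarrow>
     (\<forall>i\<in>{1..nstrips P}. \<forall>hl\<in>ifun P i Lft. \<forall>hr\<in>ifun P i Rgt. \<forall>f\<in>src P i.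
        \<exists>!v. local_solution P i hl hr f v)"

definition strip_decomposition :: "helmholtz_dd \<Rightarrow> bool" where
  "strip_decomposition P \<longleftrightarrow>
     strip_geometry P \<and> function_spaces P \<and> operators P \<and> well_posed P"

definition S :: "helmholtz_dd \<Rightarrow> nat \<Rightarrow> field \<Rightarrow> field \<Rightarrow> field \<Rightarrow> field" where
  "S P i hl hr f = (THE v. local_solution P i hl hr f v)"


section \<open>Matrices of linear operators\<close>

text \<open>
  A linear operator with domain \<open>U\<close> is encoded as a function that vanishes off \<open>U\<close>, and a matrix
  of operators has zero entries outside the index range \<open>1, \<dots>, 2 N - 2\<close>.  Hence equality of
  operator matrices is equality in HOL, and sums and differences are the pointwise ones.
\<close>

type_synonym opmatrix = "nat \<Rightarrow> nat \<Rightarrow> field \<Rightarrow> field"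

definition op_on :: "field set \<Rightarrow> (field \<Rightarrow> field) \<Rightarrow> field \<Rightarrow> field" where
  "op_on U g = (\<lambda>h. if h \<in> U then g h else 0)"

definition indices :: "helmholtz_dd \<Rightarrow> nat set" where
  "indices P = {1..2 * nstrips P - 2}"

text \<open>
  The left-right numbering \<open>(2,l), \<dots>, (N,l), (N-1,r), \<dots>, (1,r)\<close> of the interfaces.
\<close>

definition lr :: "helmholtz_dd \<Rightarrow> nat \<Rightarrow> nat \<times> side" where
  "lr P p = (if p \<le> nstrips P - 1 then (p + 1, Lft) else (2 * nstrips P - 1 - p, Rgt))"

definition comp_space :: "helmholtz_dd \<Rightarrow> nat \<Rightarrow> field set" where
  "comp_space P p = case_prod (ifun P) (lr P p)"

definition is_opmatrix :: "helmholtz_dd \<Rightarrow> opmatrix \<Rightarrow> bool" where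
  "is_opmatrix P A \<longleftrightarrow>
     (\<forall>p\<in>indices P. \<forall>q\<in>indices P.
        linear_into (comp_space P q) (comp_space P p) (A p q) \<and>
        (\<forall>h. h \<notin> comp_space P q \<longrightarrow> A p q h = 0)) \<and>
     (\<forall>p q. p \<notin> indices P \<or> q \<notin> indices P \<longrightarrow> A p q = 0)"

definition diag_id :: "helmholtz_dd \<Rightarrow> nat set \<Rightarrow> opmatrix" where
  "diag_id P J = (\<lambda>p q. if p = q \<and> p \<in> J then op_on (comp_space P p) (\<lambda>h. h) else 0)"

definition omult :: "helmholtz_dd \<Rightarrow> opmatrix \<Rightarrow> opmatrix \<Rightarrow> opmatrix" where
  "omult P A B = (\<lambda>p q h. \<Sum>s\<in>indices P. A p s (B s q h))"

definition otranspose :: "opmatrix \<Rightarrow> opmatrix" where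
  "otranspose A = (\<lambda>p q. A q p)"

definition Id_op :: "helmholtz_dd \<Rightarrow> opmatrix" where
  "Id_op P = diag_id P (indices P)"

primrec opow :: "helmholtz_dd \<Rightarrow> opmatrix \<Rightarrow> nat \<Rightarrow> opmatrix" where
  "opow P A 0 = Id_op P"
| "opow P A (Suc m) = omult P A (opow P A m)"

definition is_oinverse :: "helmholtz_dd \<Rightarrow> opmatrix \<Rightarrow> opmatrix \<Rightarrow> bool" where
  "is_oinverse P A W \<longleftrightarrow> is_opmatrix P W \<and> omult P W A = Id_op P \<and> omult P A W = Id_op P"

definition oinvertible :: "helmholtz_dd \<Rightarrow> opmatrix \<Rightarrow> bool" where
  "oinvertible P A \<longleftrightarrow> (\<exists>W. is_oinverse P A W)"

definition oinv :: "helmholtz_dd \<Rightarrow> opmatrix \<Rightarrow> opmatrix" where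
  "oinv P A = (THE W. is_oinverse P A W)"


section \<open>The substructured operator\<close>

definition T_entry :: "helmholtz_dd \<Rightarrow> nat \<times> side \<Rightarrow> nat \<times> side \<Rightarrow> field \<Rightarrow> field" where
  "T_entry P = (\<lambda>(a, s) (i, t).
     if s = Lft \<and> t = Lft \<and> a = i + 1 \<and> 2 \<le> i \<and> i \<le> nstrips P - 1
       then op_on (ifun P i Lft) (\<lambda>h. trop P (i + 1) Lft (S P i h 0 0))
     else if s = Lft \<and> t = Rgt \<and> a = i + 1 \<and> 1 \<le> i \<and> i \<le> nstrips P - 1
       then op_on (ifun P i Rgt) (\<lambda>h. trop P (i + 1) Lft (S P i 0 h 0))
     else if s = Rgt \<and> t = Rgt \<and> a + 1 = i \<and> 2 \<le> i \<and> i \<le> nstrips P - 1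
       then op_on (ifun P i Rgt) (\<lambda>h. trop P (i - 1) Rgt (S P i 0 h 0))
     else if s = Rgt \<and> t = Lft \<and> a + 1 = i \<and> 2 \<le> i \<and> i \<le> nstrips P
       then op_on (ifun P i Lft) (\<lambda>h. trop P (i - 1) Rgt (S P i h 0 0))
     else 0)"

definition T_LR :: "helmholtz_dd \<Rightarrow> opmatrix" where
  "T_LR P = (\<lambda>p q. if p \<in> indices P \<and> q \<in> indices P then T_entry P (lr P p) (lr P q) else 0)"

definition I_l :: "helmholtz_dd \<Rightarrow> opmatrix" where
  "I_l P = diag_id P {1..nstrips P - 1}"

definition I_r :: "helmholtz_dd \<Rightarrow> opmatrix" where
  "I_r P = diag_id P {nstrips P..2 * nstrips P - 2}"

definition M_l :: "helmholtz_dd \<Rightarrow> opmatrix" where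
  "M_l P = omult P (otranspose (I_l P)) (omult P (T_LR P) (I_l P))"

definition A_l :: "helmholtz_dd \<Rightarrow> opmatrix" where
  "A_l P = omult P (otranspose (I_l P)) (omult P (T_LR P) (I_r P))"

definition A_r :: "helmholtz_dd \<Rightarrow> opmatrix" where
  "A_r P = omult P (otranspose (I_r P)) (omult P (T_LR P) (I_l P))"

definition M_r :: "helmholtz_dd \<Rightarrow> opmatrix" where
  "M_r P = omult P (otranspose (I_r P)) (omult P (T_LR P) (I_r P))"

definition C_r :: "helmholtz_dd \<Rightarrow> opmatrix" where
  "C_r P = omult P (oinv P (Id_op P - M_r P)) (A_r P)"

definition C_l :: "helmholtz_dd \<Rightarrow> opmatrix" where
  "C_l P = omult P (oinv P (Id_op P - M_l P)) (A_l P)"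

definition error_propagation :: "helmholtz_dd \<Rightarrow> opmatrix \<Rightarrow> opmatrix \<Rightarrow> opmatrix" where
  "error_propagation P M B = omult P (oinv P M) (M - B)"

definition M_BJ :: "helmholtz_dd \<Rightarrow> opmatrix" where
  "M_BJ P = Id_op P - M_r P - M_l P"

definition R_BJ :: "helmholtz_dd \<Rightarrow> opmatrix" where
  "R_BJ P = error_propagation P (M_BJ P) (Id_op P - T_LR P)"

end

theory Submission
  imports Defs "HOL-Algebra.Ring"
begin

text \<open>
  The local problems are linear and uniquely solvable, so their solution operators are linear
  (\<open>S_linear\<close>) and \<open>T_LR\<close> is a matrix of linear operators between the interface spaces
  (\<open>T_LR_is_opmatrix\<close>).  Such matrices form a ring (\<open>ring_opring\<close>), and the rest is algebra in it.

  The matrices \<open>I_l\<close> and \<open>I_r\<close> are orthogonal idempotents with sum \<open>Id_op\<close>, and \<open>M_l, A_l, A_r, M_r\<close>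
  are the four blocks into which they cut \<open>T_LR\<close>.  Each of \<open>M_l\<close>, \<open>M_r\<close> and \<open>M_r + M_l\<close> is strictly
  lower triangular (\<open>T_LR_lower_in_blocks\<close>), hence nilpotent, and so the identity minus any of them
  is invertible (\<open>one_minus_strictly_lower_Units\<close>).

  The operator \<open>C_r\<close> maps left components to right ones, and \<open>C_l\<close> maps right components to left
  ones.  On right components \<open>M_BJ\<close> acts as \<open>Id_op - M_r\<close>, on left ones as \<open>Id_op - M_l\<close>; therefore
  \<open>M_BJ (C_r + C_l) = A_r + A_l\<close>.  As \<open>M_BJ - (Id_op - T_LR) = A_r + A_l\<close> too, inverting \<open>M_BJ\<close> gives
  \<open>R_BJ = C_r + C_l\<close>.  For the same reason \<open>C_r C_r = C_l C_l = 0\<close> (both in \<open>block_jacobi_error\<close>), and in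
  the powers of \<open>C_r + C_l\<close> only alternating products remain (\<open>even_power_add_of_square_zero\<close>).
\<close>

section \<open>Block Jacobi splitting in a noncommutative ring\<close>

text \<open>
  The inverse is the geometric sum \<open>\<one> \<oplus> a \<oplus> \<dots> \<oplus> a\<^sup>m\<^sup>-\<^sup>1\<close>; the induction produces its partial sums.
\<close>

lemma (in ring) one_minus_nilpotent_Units:
  assumes a: "a \<in> carrier R" and nil: "a [^] (m::nat) = \<zero>"
  shows "\<one> \<ominus> a \<in> Units R"
proof -
  have "\<exists>w\<in>carrier R. w \<otimes> (\<one> \<ominus> a) = \<one> \<ominus> a [^] k \<and> (\<one> \<ominus> a) \<otimes> w = \<one> \<ominus> a [^] k" for k :: nat
  proof (induction k)
    case 0
    show ?case using a by (intro bexI[of _ \<zero>]) (simp_all add: r_neg minus_eq)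
  next
    case (Suc k)
    then obtain w where w: "w \<in> carrier R" "w \<otimes> (\<one> \<ominus> a) = \<one> \<ominus> a [^] k"
      "(\<one> \<ominus> a) \<otimes> w = \<one> \<ominus> a [^] k" by blast
    have c: "a [^] k \<in> carrier R" using a by simp
    \<comment> \<open>Telescoping: appending the summand \<open>a [^] k\<close> moves the defect from \<open>a [^] k\<close> to \<open>a [^] Suc k\<close>.\<close>
    have "(w \<oplus> a [^] k) \<otimes> (\<one> \<ominus> a) = w \<otimes> (\<one> \<ominus> a) \<oplus> a [^] k \<otimes> (\<one> \<ominus> a)"
      "(\<one> \<ominus> a) \<otimes> (w \<oplus> a [^] k) = (\<one> \<ominus> a) \<otimes> w \<oplus> (\<one> \<ominus> a) \<otimes> a [^] k"
      using a w c by (simp_all only: l_distr r_distr minus_closed one_closed)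
    moreover have "a [^] k \<otimes> (\<one> \<ominus> a) = a [^] k \<ominus> a [^] k \<otimes> a" "(\<one> \<ominus> a) \<otimes> a [^] k = a [^] k \<ominus> a \<otimes> a [^] k"
      using a c by (simp_all add: l_distr r_distr l_minus r_minus minus_eq)
    moreover have "(\<one> \<ominus> x) \<oplus> (x \<ominus> y) = \<one> \<ominus> y" if "x \<in> carrier R" "y \<in> carrier R" for x y
      using that by (simp add: minus_eq a_assoc r_neg1 r_neg2)
    ultimately show ?case
      using a w c nat_pow_Suc2[OF a, of k] by (intro bexI[of _ "w \<oplus> a [^] k"]) simp_all
  qed
  from this[of m] show ?thesis
    using a nil by (auto simp: Units_def minus_eq)
qed

text \<open>
  With orthogonal idempotents \<open>e\<close> and \<open>f\<close>, the elements \<open>ml, al, ar, mr\<close> are the blocks of \<open>t\<close>.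
  Everything rests on \<open>f \<otimes> cl = \<zero>\<close> and \<open>e \<otimes> cr = \<zero>\<close>.  Since \<open>ml\<close> and \<open>al\<close> begin with \<open>e\<close>, so does
  \<open>cl = al \<oplus> ml \<otimes> cl\<close>; every block that ends with \<open>f\<close> therefore annihilates \<open>cl\<close>, in particular
  \<open>al\<close> and \<open>mr\<close>.  The first gives \<open>cl \<otimes> cl = \<zero>\<close>, the second makes \<open>\<one> \<ominus> mr \<ominus> ml\<close> act on \<open>cl\<close> as
  \<open>\<one> \<ominus> ml\<close>.  The same holds with the two sides exchanged.
\<close>

lemma (in ring) block_jacobi_error:
  assumes car: "e \<in> carrier R" "f \<in> carrier R" "t \<in> carrier R"
    and orth: "e \<otimes> f = \<zero>" "f \<otimes> e = \<zero>"
    and blocks: "ml = e \<otimes> (t \<otimes> e)" "al = e \<otimes> (t \<otimes> f)" "ar = f \<otimes> (t \<otimes> e)" "mr = f \<otimes> (t \<otimes> f)"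
    and units: "\<one> \<ominus> ml \<in> Units R" "\<one> \<ominus> mr \<in> Units R"
    and c: "cl = inv (\<one> \<ominus> ml) \<otimes> al" "cr = inv (\<one> \<ominus> mr) \<otimes> ar"
  shows "(\<one> \<ominus> mr \<ominus> ml) \<otimes> (cr \<oplus> cl) = al \<oplus> ar" "cl \<otimes> cl = \<zero>" "cr \<otimes> cr = \<zero>"
proof -
  have kill: "e \<otimes> (f \<otimes> x) = \<zero>" "f \<otimes> (e \<otimes> x) = \<zero>" if "x \<in> carrier R" for x
    using that car orth by (simp_all add: m_assoc[symmetric])
  have bc: "ml \<in> carrier R" "al \<in> carrier R" "ar \<in> carrier R" "mr \<in> carrier R"
    using car blocks by simp_all
  have cc: "cl \<in> carrier R" "cr \<in> carrier R" using bc units c by simp_all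
  have sl: "(\<one> \<ominus> ml) \<otimes> cl = al" and sr: "(\<one> \<ominus> mr) \<otimes> cr = ar"
    using units bc unfolding c by (simp_all add: m_assoc[symmetric] Units_closed)
  have fixpoint: "y = b \<oplus> x \<otimes> y" if "(\<one> \<ominus> x) \<otimes> y = b" "x \<in> carrier R" "y \<in> carrier R" for x y b
    using that by (auto simp: minus_eq l_distr l_minus a_assoc l_neg)
  \<comment> \<open>\<open>cl\<close> takes values in the left block and \<open>cr\<close> in the right block.\<close>
  have "f \<otimes> cl = f \<otimes> (al \<oplus> ml \<otimes> cl)" using fixpoint[OF sl] bc cc by simp
  also have "\<dots> = \<zero>" using car cc by (simp add: blocks r_distr m_assoc kill)
  finally have fl: "f \<otimes> cl = \<zero>" .
  have "e \<otimes> cr = e \<otimes> (ar \<oplus> mr \<otimes> cr)" using fixpoint[OF sr] bc cc by simp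
  also have "\<dots> = \<zero>" using car cc by (simp add: blocks r_distr m_assoc kill)
  finally have er: "e \<otimes> cr = \<zero>" .
  have mixed: "mr \<otimes> cl = \<zero>" "ml \<otimes> cr = \<zero>" "al \<otimes> cl = \<zero>" "ar \<otimes> cr = \<zero>"
    using car cc fl er by (simp_all add: blocks m_assoc)
  have "cl \<otimes> cl = inv (\<one> \<ominus> ml) \<otimes> (al \<otimes> cl)" "cr \<otimes> cr = inv (\<one> \<ominus> mr) \<otimes> (ar \<otimes> cr)"
    using units bc cc by (simp_all add: c m_assoc)
  then show "cl \<otimes> cl = \<zero>" "cr \<otimes> cr = \<zero>" using mixed units by simp_all
  have "(\<one> \<ominus> mr \<ominus> ml) \<otimes> (cr \<oplus> cl) =
      ((\<one> \<ominus> mr) \<otimes> cr \<ominus> ml \<otimes> cr) \<oplus> ((\<one> \<ominus> ml) \<otimes> cl \<ominus> mr \<otimes> cl)"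
    using bc cc by (simp add: minus_eq l_distr r_distr l_minus a_ac)
  also have "\<dots> = al \<oplus> ar" using mixed sl sr bc by (simp add: minus_eq a_comm)
  finally show "(\<one> \<ominus> mr \<ominus> ml) \<otimes> (cr \<oplus> cl) = al \<oplus> ar" .
qed

text \<open>
  In the expansion of the power only the two alternating words in \<open>x\<close> and \<open>y\<close> survive, because all
  other words contain \<open>x \<otimes> x\<close> or \<open>y \<otimes> y\<close>.  The exponent \<open>0\<close> is exceptional: there the right-hand
  side is \<open>\<one> \<oplus> \<one>\<close>.
\<close>

lemma (in ring) even_power_add_of_square_zero:
  assumes car: "x \<in> carrier R" "y \<in> carrier R" and sq: "x \<otimes> x = \<zero>" "y \<otimes> y = \<zero>"
    and n: "even n" "n > 0"
  shows "(x \<oplus> y) [^] (n::nat) = (x \<otimes> y) [^] (n div 2) \<oplus> (y \<otimes> x) [^] (n div 2)"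
proof -
  have kill: "x \<otimes> (x \<otimes> z) = \<zero>" "y \<otimes> (y \<otimes> z) = \<zero>" if "z \<in> carrier R" for z
    using that car sq by (simp_all add: m_assoc[symmetric])
  have square: "(x \<oplus> y) [^] (2::nat) = x \<otimes> y \<oplus> y \<otimes> x"
    using car sq by (simp add: numeral_2_eq_2 l_distr r_distr a_comm)
  have step: "(x \<oplus> y) [^] (2 * Suc m) = (x \<otimes> y) [^] Suc m \<oplus> (y \<otimes> x) [^] Suc m" for m
  proof (induction m)
    case 0
    show ?case using square car by (simp add: l_distr r_distr sq)
  next
    case (Suc m)
    have "(x \<oplus> y) [^] (2 * Suc (Suc m)) = (x \<oplus> y) [^] (2 * Suc m) \<otimes> (x \<oplus> y) [^] (2::nat)"
      using car nat_pow_mult[of "x \<oplus> y" "2 * Suc m" 2] by simp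
    also have "\<dots> = ((x \<otimes> y) [^] Suc m \<oplus> (y \<otimes> x) [^] Suc m) \<otimes> (x \<otimes> y \<oplus> y \<otimes> x)"
      using Suc square by simp
    also have "\<dots> = (x \<otimes> y) [^] Suc (Suc m) \<oplus> (y \<otimes> x) [^] Suc (Suc m)"
      using car by (simp add: l_distr r_distr m_assoc kill)
    finally show ?case .
  qed
  obtain m where "n = 2 * Suc m" using n by (metis evenE gr0_implies_Suc mult_eq_0_iff neq0_conv)
  then show ?thesis using step[of m] by (simp del: nat_pow_Suc)
qed

section \<open>Linear maps between spaces of functions\<close>

lemma linear_into_0:
  assumes "linear_into U W g" "cfun.subspace U"
  shows "g 0 = 0"
proof -
  have "0 \<in> U" using assms cfun.subspace_0 by blast
  then have "g (cscale 0 0) = cscale 0 (g 0)" using assms(1) unfolding linear_into_def by blast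
  then show ?thesis by simp
qed

lemma linear_into_sum:
  assumes "linear_into U W g" "cfun.subspace U" "\<And>s. s \<in> J \<Longrightarrow> u s \<in> U"
  shows "g (\<Sum>s\<in>J. u s) = (\<Sum>s\<in>J. g (u s))"
  using assms(3)
proof (induction J rule: infinite_finite_induct)
  case (insert s J)
  then have "u s \<in> U" "(\<Sum>s\<in>J. u s) \<in> U" by (auto intro: cfun.subspace_sum[OF assms(2)])
  then have "g (u s + (\<Sum>s\<in>J. u s)) = g (u s) + g (\<Sum>s\<in>J. u s)"
    using assms(1) unfolding linear_into_def by blast
  with insert show ?case by (simp only: sum.insert insert_iff simp_thms)
qed (simp_all add: linear_into_0[OF assms(1,2)])

lemma linear_into_compose:
  assumes "linear_into U V g" "linear_into V W h"
  shows "linear_into U W (\<lambda>u. h (g u))"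
  using assms by (simp add: linear_into_def)

lemma linear_into_op_on:
  assumes "linear_into U W g" "cfun.subspace U"
  shows "linear_into U W (op_on U g)"
  using assms by (simp add: linear_into_def op_on_def cfun.subspace_add cfun.subspace_scale)

lemma linear_into_zero:
  assumes "cfun.subspace W"
  shows "linear_into U W 0"
  using assms by (simp add: linear_into_def cfun.subspace_0)

section \<open>Linearity of the Helmholtz equation\<close>

lemma partial_eq_0_on_open:
  assumes "open V" "\<And>x. x \<in> V \<Longrightarrow> u x = 0" "x \<in> V"
  shows "partial j u x = 0"
proof -
  let ?l = "\<lambda>t::real. x + t *\<^sub>R axis j 1"
  have "open (?l -` V)"
    by (intro open_vimage assms(1) continuous_intros)
  moreover have "0 \<in> ?l -` V" using assms(3) by simp
  moreover have "0 = u (?l t)" if "t \<in> ?l -` V" for t using that assms(2) by simp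
  ultimately have "((\<lambda>t. u (?l t)) has_vector_derivative 0) (at 0)"
    by (rule has_vector_derivative_transform_within_open[OF has_vector_derivative_const])
  then show ?thesis by (simp add: partial_def vector_derivative_at)
qed

lemma laplacian_eq_0_on_open:
  assumes "open V" "\<And>x. x \<in> V \<Longrightarrow> u x = 0" "x \<in> V"
  shows "laplacian u x = 0"
proof -
  have "partial j u y = 0" if "y \<in> V" for j y
    using assms(1,2) that by (rule partial_eq_0_on_open)
  then have "partial j (partial j u) x = 0" for j
    by (rule partial_eq_0_on_open[OF assms(1) _ assms(3)])
  then show ?thesis by (simp add: laplacian_def)
qed

text \<open>
  A locally integrable function may fail to be integrable over \<open>U\<close>; multiplication by a bounded
  factor living on a compact part of \<open>U\<close> repairs this.
\<close>

lemma integrable_times_compactly_supported: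
  assumes v: "locally_integrable U v" and g: "continuous_on UNIV g"
    and K: "compact K" "K \<subseteq> U" "\<And>x. x \<notin> K \<Longrightarrow> g x = 0"
  shows "set_integrable lebesgue U (\<lambda>x. v x * g x)"
proof -
  have "(\<lambda>x. g x * v x) absolutely_integrable_on K"
  proof (rule absolutely_integrable_bounded_measurable_product[where h="(*)"])
    show "bilinear ((*) :: complex \<Rightarrow> _)" by (rule bilinear_times)
    show "K \<in> sets lebesgue" using K(1) by (simp add: compact_imp_closed)
    have cont: "continuous_on K g" using g continuous_on_subset by blast
    show "g \<in> borel_measurable (lebesgue_on K)"
      using cont \<open>K \<in> sets lebesgue\<close> by (rule continuous_imp_measurable_on_sets_lebesgue)
    show "bounded (g ` K)" using cont K(1) by (simp add: compact_continuous_image compact_imp_bounded)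
    show "v absolutely_integrable_on K" using v K unfolding locally_integrable_def by blast
  qed
  moreover have "(\<lambda>x. indicator K x *\<^sub>R (g x * v x)) = (\<lambda>x. indicator U x *\<^sub>R (v x * g x))"
    using K by (auto simp: fun_eq_iff indicator_def)
  ultimately show ?thesis by (simp add: set_integrable_def)
qed

lemma test_function_continuous:
  assumes "test_function U \<phi>"
  shows "continuous_on UNIV \<phi>" "continuous_on UNIV (laplacian \<phi>)"
proof -
  have "Ck (Suc (Suc 0)) \<phi>" using assms unfolding test_function_def by blast
  then have "continuous_on UNIV \<phi> \<and> (\<forall>j. continuous_on UNIV (partial j (partial j \<phi>)))"
    unfolding Ck.simps by blast
  then show "continuous_on UNIV \<phi>" "continuous_on UNIV (laplacian \<phi>)"
    unfolding laplacian_def[abs_def] by (auto intro: continuous_on_sum)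
qed

lemma set_integrable_times_test_function:
  assumes \<phi>: "test_function U \<phi>" and u: "locally_integrable U u"
  shows "set_integrable lebesgue U (\<lambda>x. u x * (- (k\<^sup>2) * \<phi> x - laplacian \<phi> x))"
    and "set_integrable lebesgue U (\<lambda>x. u x * \<phi> x)"
proof -
  let ?K = "closure {x. \<phi> x \<noteq> 0}"
  have K: "compact ?K" "?K \<subseteq> U" using \<phi> by (auto simp: test_function_def)
  have out: "\<phi> x = 0" if "x \<notin> ?K" for x
    using that subsetD[OF closure_subset, of x "{x. \<phi> x \<noteq> 0}"] by (cases "\<phi> x = 0") simp_all
  have lap: "laplacian \<phi> x = 0" if "x \<notin> ?K" for x
    by (rule laplacian_eq_0_on_open[OF open_Compl[OF closed_closure], where x = x])
      (use that out in \<open>simp_all only: Compl_iff\<close>)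
  note cont = test_function_continuous[OF \<phi>]
  show "set_integrable lebesgue U (\<lambda>x. u x * (- (k\<^sup>2) * \<phi> x - laplacian \<phi> x))"
  proof (rule integrable_times_compactly_supported[OF u _ K])
    show "continuous_on UNIV (\<lambda>x. - (k\<^sup>2) * \<phi> x - laplacian \<phi> x)"
      by (intro continuous_intros cont)
    show "- (k\<^sup>2) * \<phi> x - laplacian \<phi> x = 0" if "x \<notin> ?K" for x
      using out[OF that] lap[OF that] by simp
  qed
  show "set_integrable lebesgue U (\<lambda>x. u x * \<phi> x)"
    by (rule integrable_times_compactly_supported[OF u cont(1) K]) (rule out)
qed

text \<open>
  Local integrability is needed because the integral of a non-integrable function is \<open>0\<close> by
  convention, and then it is not additive.
\<close>

lemma helmholtz_add:
  assumes "helmholtz k U u f" "helmholtz k U v g"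
    and "locally_integrable U u" "locally_integrable U v" "locally_integrable U f" "locally_integrable U g"
  shows "helmholtz k U (u + v) (f + g)"
  unfolding helmholtz_def
proof (intro allI impI)
  fix \<phi> assume \<phi>: "test_function U \<phi>"
  show "(LINT x:U|lebesgue. (u + v) x * (- k\<^sup>2 * \<phi> x - laplacian \<phi> x)) =
      (LINT x:U|lebesgue. (f + g) x * \<phi> x)"
    using set_integrable_times_test_function[OF \<phi>] assms \<phi>
    by (simp add: distrib_right set_integral_add helmholtz_def)
qed

lemma helmholtz_cscale:
  assumes "helmholtz k U u f"
  shows "helmholtz k U (cscale c u) (cscale c f)"
  using assms by (simp add: helmholtz_def cscale_def mult.assoc)

section \<open>Linearity of the local solution operators\<close>

lemma local_operators_linear:
  assumes P: "strip_decomposition P" and i: "i \<in> {1..nstrips P}"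
  shows "cfun.subspace (vol P i)" "linear_into (vol P i) UNIV (bcop P i)"
    and "i \<ge> 2 \<Longrightarrow> linear_into (vol P i) (ifun P i Lft) (trop P i Lft)"
    and "i \<le> nstrips P - 1 \<Longrightarrow> linear_into (vol P i) (ifun P i Rgt) (trop P i Rgt)"
  using P i
  by (auto simp: strip_decomposition_def function_spaces_def operators_def interface_operator_def)

lemma local_solution_add:
  assumes P: "strip_decomposition P" and i: "i \<in> {1..nstrips P}"
    and u: "local_solution P i hl hr f u" and v: "local_solution P i hl' hr' f' v"
    and f: "f \<in> src P i" "f' \<in> src P i"
  shows "local_solution P i (hl + hl') (hr + hr') (f + f') (u + v)"
proof -
  note lin = local_operators_linear[OF P i]
  have int: "\<And>w. w \<in> vol P i \<union> src P i \<Longrightarrow> locally_integrable (subdom P i) w"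
    using P i by (auto simp: strip_decomposition_def function_spaces_def)
  have uv: "u \<in> vol P i" "v \<in> vol P i" using u v by (auto simp: local_solution_def)
  show ?thesis
    unfolding local_solution_def
  proof (intro conjI impI ballI)
    show "u + v \<in> vol P i" using lin(1) uv by (simp add: cfun.subspace_add)
    show "helmholtz (wavenum P) (subdom P i) (u + v) (f + f')"
      using u v f uv int by (intro helmholtz_add) (auto simp: local_solution_def)
    show "trop P i Lft (u + v) = hl + hl'" if "2 \<le> i"
      using lin(3)[OF that] u v uv that by (simp add: local_solution_def linear_into_def)
    show "trop P i Rgt (u + v) = hr + hr'" if "i \<le> nstrips P - 1"
      using lin(4)[OF that] u v uv that by (simp add: local_solution_def linear_into_def)
    show "bcop P i (u + v) x = 0" if "x \<in> frontier (dom P) \<inter> frontier (subdom P i)" for x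
      using lin(2) u v uv that by (simp add: local_solution_def linear_into_def)
  qed
qed

lemma local_solution_cscale:
  assumes P: "strip_decomposition P" and i: "i \<in> {1..nstrips P}"
    and u: "local_solution P i hl hr f u"
  shows "local_solution P i (cscale c hl) (cscale c hr) (cscale c f) (cscale c u)"
proof -
  note lin = local_operators_linear[OF P i]
  have vol: "u \<in> vol P i" using u by (auto simp: local_solution_def)
  show ?thesis
    unfolding local_solution_def
  proof (intro conjI impI ballI)
    show "cscale c u \<in> vol P i" using lin(1) vol by (simp add: cfun.subspace_scale)
    show "helmholtz (wavenum P) (subdom P i) (cscale c u) (cscale c f)"
      using u by (intro helmholtz_cscale) (auto simp: local_solution_def)
    show "trop P i Lft (cscale c u) = cscale c hl" if "2 \<le> i"
      using lin(3)[OF that] u vol that by (simp add: local_solution_def linear_into_def)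
    show "trop P i Rgt (cscale c u) = cscale c hr" if "i \<le> nstrips P - 1"
      using lin(4)[OF that] u vol that by (simp add: local_solution_def linear_into_def)
    show "bcop P i (cscale c u) x = 0" if "x \<in> frontier (dom P) \<inter> frontier (subdom P i)" for x
      using lin(2) u vol that by (simp add: local_solution_def linear_into_def cscale_def)
  qed
qed

lemma S_solves:
  assumes "strip_decomposition P" "i \<in> {1..nstrips P}"
    and "hl \<in> ifun P i Lft" "hr \<in> ifun P i Rgt" "f \<in> src P i"
  shows "local_solution P i hl hr f (S P i hl hr f)"
proof -
  have "\<exists>!v. local_solution P i hl hr f v"
    using assms by (simp add: strip_decomposition_def well_posed_def)
  then show ?thesis unfolding S_def by (rule theI')
qed

lemma S_eqI:
  assumes "strip_decomposition P" "i \<in> {1..nstrips P}"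
    and "hl \<in> ifun P i Lft" "hr \<in> ifun P i Rgt" "f \<in> src P i"
    and "local_solution P i hl hr f v"
  shows "S P i hl hr f = v"
proof -
  have "\<exists>!v. local_solution P i hl hr f v"
    using assms by (simp add: strip_decomposition_def well_posed_def)
  then show ?thesis unfolding S_def using assms(6)
    by (rule the1_equality[where P = "local_solution P i hl hr f"])
qed

text \<open>
  By uniqueness: the same linear combination of the two solutions solves the problem with the
  combined data.
\<close>

lemma S_linear:
  assumes P: "strip_decomposition P" and i: "i \<in> {1..nstrips P}"
  shows "linear_into (ifun P i Lft) (vol P i) (\<lambda>h. S P i h 0 0)"
    and "linear_into (ifun P i Rgt) (vol P i) (\<lambda>h. S P i 0 h 0)"
proof -
  have sp: "cfun.subspace (ifun P i s)" "cfun.subspace (src P i)" for s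
    using P i by (auto simp: strip_decomposition_def function_spaces_def)
  note z = cfun.subspace_0[OF sp(1)] cfun.subspace_0[OF sp(2)]
  note add = cfun.subspace_add[OF sp(1)] and scale = cfun.subspace_scale[OF sp(1)]
  note sol = S_solves[OF P i] and eqI = S_eqI[OF P i]
  note sum = local_solution_add[OF P i sol sol] and multiple = local_solution_cscale[OF P i sol]
  have vol: "S P i hl hr 0 \<in> vol P i" if "hl \<in> ifun P i Lft" "hr \<in> ifun P i Rgt" for hl hr
    using sol[of hl hr 0] that z by (simp add: local_solution_def)
  show "linear_into (ifun P i Lft) (vol P i) (\<lambda>h. S P i h 0 0)"
    unfolding linear_into_def
  proof (intro conjI ballI allI)
    fix u assume u: "u \<in> ifun P i Lft"
    show "S P i u 0 0 \<in> vol P i" using u z vol by simp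
    show "S P i (u + v) 0 0 = S P i u 0 0 + S P i v 0 0" if "v \<in> ifun P i Lft" for v
      using sum[of u 0 0 v 0 0] u that z add by (intro eqI) auto
    show "S P i (cscale c u) 0 0 = cscale c (S P i u 0 0)" for c
      using multiple[of u 0 0 c] u z scale by (intro eqI) auto
  qed
  show "linear_into (ifun P i Rgt) (vol P i) (\<lambda>h. S P i 0 h 0)"
    unfolding linear_into_def
  proof (intro conjI ballI allI)
    fix u assume u: "u \<in> ifun P i Rgt"
    show "S P i 0 u 0 \<in> vol P i" using u z vol by simp
    show "S P i 0 (u + v) 0 = S P i 0 u 0 + S P i 0 v 0" if "v \<in> ifun P i Rgt" for v
      using sum[of 0 u 0 0 v 0] u that z add by (intro eqI) auto
    show "S P i 0 (cscale c u) 0 = cscale c (S P i 0 u 0)" for c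
      using multiple[of 0 u 0 c] u z scale by (intro eqI) auto
  qed
qed

section \<open>The substructured operator as a matrix of linear operators\<close>

lemma lr_strip:
  assumes "p \<in> indices P" "lr P p = (a, s)"
  shows "a \<in> {1..nstrips P}"
  using assms by (auto simp: indices_def lr_def split: if_splits)

lemma subspace_comp_space:
  assumes "strip_decomposition P" "p \<in> indices P"
  shows "cfun.subspace (comp_space P p)"
  using assms lr_strip[of p P]
  by (cases "lr P p") (auto simp: comp_space_def strip_decomposition_def function_spaces_def)

text \<open>
  An entry evaluates, on an interface of a neighbouring strip, the solution on strip \<open>i\<close>.  An
  interface operator is linear on the spaces of the two adjacent strips, and strip \<open>i\<close> is one of
  them.
\<close>

lemma T_entry_linear:
  assumes P: "strip_decomposition P" and a: "a \<in> {1..nstrips P}" and i: "i \<in> {1..nstrips P}"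
  shows "linear_into (ifun P i t) (ifun P a s) (T_entry P (a, s) (i, t))"
proof -
  have sp: "cfun.subspace (ifun P j s)" if "j \<in> {1..nstrips P}" for j s
    using P that by (auto simp: strip_decomposition_def function_spaces_def)
  have op: "linear_into (vol P j) (ifun P b Lft) (trop P b Lft)"
    if "b \<in> {2..nstrips P}" "j \<in> {b - 1, b}" for b j
    using P that unfolding strip_decomposition_def operators_def interface_operator_def by blast
  have op': "linear_into (vol P j) (ifun P b Rgt) (trop P b Rgt)"
    if "b \<in> {1..nstrips P - 1}" "j \<in> {b, b + 1}" for b j
    using P that unfolding strip_decomposition_def operators_def interface_operator_def by blast
  have right: "linear_into (ifun P i t) (ifun P (i + 1) Lft)
      (op_on (ifun P i t) (\<lambda>h. trop P (i + 1) Lft (g h)))"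
    if "i \<le> nstrips P - 1" "linear_into (ifun P i t) (vol P i) g" for g
    using that i by (intro linear_into_op_on sp linear_into_compose[OF that(2)] op) auto
  have left: "linear_into (ifun P i t) (ifun P (i - 1) Rgt)
      (op_on (ifun P i t) (\<lambda>h. trop P (i - 1) Rgt (g h)))"
    if "2 \<le> i" "linear_into (ifun P i t) (vol P i) g" for g
    using that i by (intro linear_into_op_on sp linear_into_compose[OF that(2)] op') auto
  show ?thesis
    using right left S_linear[OF P i] linear_into_zero[OF sp[OF a]]
    by (cases s; cases t) (auto simp: T_entry_def)
qed

lemma T_entry_eq_0:
  assumes "h \<notin> ifun P i t"
  shows "T_entry P (a, s) (i, t) h = 0"
  using assms by (cases s; cases t) (auto simp: T_entry_def op_on_def)

lemma T_LR_is_opmatrix: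
  assumes P: "strip_decomposition P"
  shows "is_opmatrix P (T_LR P)"
  unfolding is_opmatrix_def
proof (intro conjI ballI allI impI)
  fix p q assume pq: "p \<in> indices P" "q \<in> indices P"
  obtain a s where p: "lr P p = (a, s)" by fastforce
  obtain i t where q: "lr P q = (i, t)" by fastforce
  show "linear_into (comp_space P q) (comp_space P p) (T_LR P p q)"
    using T_entry_linear[OF P lr_strip[OF pq(1) p] lr_strip[OF pq(2) q]] pq
    by (simp add: T_LR_def comp_space_def p q)
  show "T_LR P p q h = 0" if "h \<notin> comp_space P q" for h
    using T_entry_eq_0 that pq by (simp add: T_LR_def comp_space_def p q)
next
  fix p q assume "p \<notin> indices P \<or> q \<notin> indices P"
  then show "T_LR P p q = 0" by (auto simp: T_LR_def)
qed

section \<open>The ring of operator matrices\<close>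

lemma opmatrix_apply_mem:
  assumes "is_opmatrix P A" "p \<in> indices P" "cfun.subspace (comp_space P p)"
  shows "A p q h \<in> comp_space P p"
proof -
  consider "q \<in> indices P" "h \<in> comp_space P q" | "q \<in> indices P" "h \<notin> comp_space P q" | "q \<notin> indices P"
    by blast
  then show ?thesis
    using assms cfun.subspace_0[of "comp_space P p"]
    by cases (auto simp: is_opmatrix_def linear_into_def)
qed

lemma opmatrix_outside:
  assumes "is_opmatrix P A" "p \<notin> indices P \<or> q \<notin> indices P"
  shows "A p q = 0"
  using assms by (simp add: is_opmatrix_def)

lemma opmatrix_off_domain:
  assumes "is_opmatrix P A" "h \<notin> comp_space P q"
  shows "A p q h = 0"
  using assms by (cases "p \<in> indices P \<and> q \<in> indices P") (auto simp: is_opmatrix_def)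

lemma opmatrix_linear:
  assumes "is_opmatrix P A" "p \<in> indices P" "q \<in> indices P"
  shows "linear_into (comp_space P q) (comp_space P p) (A p q)"
  using assms by (simp add: is_opmatrix_def)

text \<open>
  The operator matrices as a ring object, so that identities between them are computed by
  noncommutative ring algebra.
\<close>

definition opring :: "helmholtz_dd \<Rightarrow> opmatrix ring" where
  "opring P = \<lparr>carrier = {A. is_opmatrix P A}, mult = omult P, one = Id_op P,
     zero = 0, add = (+)\<rparr>"

lemma opring_simps [simp]:
  "carrier (opring P) = {A. is_opmatrix P A}" "A \<otimes>\<^bsub>opring P\<^esub> B = omult P A B"
  "\<one>\<^bsub>opring P\<^esub> = Id_op P" "\<zero>\<^bsub>opring P\<^esub> = 0" "A \<oplus>\<^bsub>opring P\<^esub> B = A + B"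
  by (simp_all add: opring_def)

text \<open>
  That the component spaces are subspaces is all that the ring structure depends on.
\<close>

locale component_subspaces =
  fixes P :: helmholtz_dd
  assumes subspace: "p \<in> indices P \<Longrightarrow> cfun.subspace (comp_space P p)"
begin

lemma is_opmatrix_zero: "is_opmatrix P 0"
  by (simp add: is_opmatrix_def linear_into_zero subspace)

lemma is_opmatrix_add:
  assumes "is_opmatrix P A" "is_opmatrix P B"
  shows "is_opmatrix P (A + B)"
  using assms subspace
  by (auto simp: is_opmatrix_def linear_into_def cfun.subspace_add cfun.scale_right_distrib)

lemma is_opmatrix_uminus:
  assumes "is_opmatrix P A"
  shows "is_opmatrix P (- A)"
  using assms subspace
  by (auto simp: is_opmatrix_def linear_into_def cfun.subspace_neg)

lemma is_opmatrix_diag_id: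
  assumes "J \<subseteq> indices P"
  shows "is_opmatrix P (diag_id P J)"
proof -
  have "linear_into (comp_space P p) (comp_space P p) (op_on (comp_space P p) (\<lambda>h. h))"
    if "p \<in> indices P" for p
    by (rule linear_into_op_on[OF _ subspace[OF that]]) (simp add: linear_into_def)
  then show ?thesis
    using assms linear_into_zero[OF subspace]
    by (auto simp: is_opmatrix_def diag_id_def op_on_def)
qed

lemma is_opmatrix_omult:
  assumes A: "is_opmatrix P A" and B: "is_opmatrix P B"
  shows "is_opmatrix P (omult P A B)"
  unfolding is_opmatrix_def
proof (intro conjI ballI allI impI)
  fix p q assume pq: "p \<in> indices P" "q \<in> indices P"
  have lin: "linear_into (comp_space P q) (comp_space P p) (\<lambda>h. A p s (B s q h))"
    if "s \<in> indices P" for s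
    using linear_into_compose[OF opmatrix_linear[OF B that pq(2)] opmatrix_linear[OF A pq(1) that]] .
  show "linear_into (comp_space P q) (comp_space P p) (omult P A B p q)"
    unfolding linear_into_def omult_def
  proof (intro conjI ballI allI)
    show "(\<Sum>s\<in>indices P. A p s (B s q u)) \<in> comp_space P p" for u
      by (intro cfun.subspace_sum opmatrix_apply_mem A subspace pq)
    show "(\<Sum>s\<in>indices P. A p s (B s q (u + v))) =
        (\<Sum>s\<in>indices P. A p s (B s q u)) + (\<Sum>s\<in>indices P. A p s (B s q v))"
      if "u \<in> comp_space P q" "v \<in> comp_space P q" for u v
      unfolding sum.distrib[symmetric]
      using lin that by (intro sum.cong refl) (simp add: linear_into_def)
    show "(\<Sum>s\<in>indices P. A p s (B s q (cscale c u))) = cscale c (\<Sum>s\<in>indices P. A p s (B s q u))"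
      if "u \<in> comp_space P q" for c u
      unfolding cfun.scale_sum_right
      using lin that by (intro sum.cong refl) (simp add: linear_into_def)
  qed
next
  have zero: "A p s 0 = 0" if "s \<in> indices P" for p s
    using linear_into_0[OF opmatrix_linear[OF A _ that] subspace[OF that]] opmatrix_outside[OF A, of p s]
    by (cases "p \<in> indices P") auto
  show "omult P A B p q h = 0" if "h \<notin> comp_space P q" for p q h
    using opmatrix_off_domain[OF B that] zero by (simp add: omult_def)
  show "omult P A B p q = 0" if "p \<notin> indices P \<or> q \<notin> indices P" for p q
  proof -
    have "A p s (B s q h) = 0" if "s \<in> indices P" for s h
      using \<open>p \<notin> indices P \<or> q \<notin> indices P\<close> opmatrix_outside[OF A, of p s]
        opmatrix_outside[OF B, of s q] zero[OF that, of p] by auto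
    then show ?thesis by (intro ext) (simp add: omult_def)
  qed
qed

lemma opmatrix_apply_sum:
  assumes A: "is_opmatrix P A" and s: "s \<in> indices P" and u: "\<And>t. t \<in> J \<Longrightarrow> u t \<in> comp_space P s"
  shows "A p s (\<Sum>t\<in>J. u t) = (\<Sum>t\<in>J. A p s (u t))"
proof (cases "p \<in> indices P")
  case True
  show ?thesis by (rule linear_into_sum[OF opmatrix_linear[OF A True s] subspace[OF s] u])
next
  case False
  then show ?thesis using opmatrix_outside[OF A, of p s] by simp
qed

text \<open>
  Composition distributes over the inner sum only because the entries of \<open>A\<close> are additive.
\<close>

lemma omult_assoc:
  assumes A: "is_opmatrix P A" and B: "is_opmatrix P B" and C: "is_opmatrix P C"
  shows "omult P (omult P A B) C = omult P A (omult P B C)"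
proof (intro ext)
  fix p q h
  have "omult P A (omult P B C) p q h =
      (\<Sum>t\<in>indices P. \<Sum>s\<in>indices P. A p t (B t s (C s q h)))"
    unfolding omult_def
    by (intro sum.cong refl opmatrix_apply_sum A opmatrix_apply_mem B subspace)
  also have "\<dots> = omult P (omult P A B) C p q h"
    unfolding omult_def by (rule sum.swap)
  finally show "omult P (omult P A B) C p q h x = omult P A (omult P B C) p q h x" for x
    by simp
qed

lemma omult_diag_id_left:
  assumes "is_opmatrix P A" "J \<subseteq> indices P"
  shows "omult P (diag_id P J) A = (\<lambda>p q. if p \<in> J then A p q else 0)"
proof -
  have "finite (indices P)" by (simp add: indices_def)
  moreover have "diag_id P J p s (A s q h) = (if s = p \<and> p \<in> J then A p q h else 0)"
    if "s \<in> indices P" for p q s h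
    using opmatrix_apply_mem[OF assms(1) that subspace[OF that]] by (auto simp: diag_id_def op_on_def)
  ultimately have "omult P (diag_id P J) A p q h = (if p \<in> J then A p q h else 0)" for p q h
    using assms(2) by (auto simp: omult_def sum.delta)
  then show ?thesis by (intro ext) auto
qed

lemma omult_diag_id_right:
  assumes A: "is_opmatrix P A" and J: "J \<subseteq> indices P"
  shows "omult P A (diag_id P J) = (\<lambda>p q. if q \<in> J then A p q else 0)"
proof -
  have fin: "finite (indices P)" by (simp add: indices_def)
  have zero: "A p s 0 = 0" for p s
  proof (cases "s \<in> indices P")
    case True
    then show ?thesis using opmatrix_apply_sum[OF A True, of "{}"] by simp
  qed (simp add: opmatrix_outside[OF A])
  have "A p s (diag_id P J s q h) = (if s = q then if q \<in> J then A p q h else 0 else 0)" for p q s h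
    using opmatrix_off_domain[OF A, of h q p] zero by (auto simp: diag_id_def op_on_def)
  then have "omult P A (diag_id P J) p q h = (if q \<in> J then A p q h else 0)" for p q h
    using J fin by (auto simp: omult_def sum.delta)
  then show ?thesis by (intro ext) auto
qed

lemma omult_diag_id_both:
  assumes A: "is_opmatrix P A" and J: "J \<subseteq> indices P" and K: "K \<subseteq> indices P"
  shows "omult P (diag_id P J) (omult P A (diag_id P K)) = (\<lambda>p q. if p \<in> J \<and> q \<in> K then A p q else 0)"
  unfolding omult_diag_id_left[OF is_opmatrix_omult[OF A is_opmatrix_diag_id[OF K]] J]
  unfolding omult_diag_id_right[OF A K]
  by (intro ext) simp

lemma Id_op_omult:
  assumes "is_opmatrix P A"
  shows "omult P (Id_op P) A = A" "omult P A (Id_op P) = A"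
  unfolding Id_op_def omult_diag_id_left[OF assms subset_refl] omult_diag_id_right[OF assms subset_refl]
  using opmatrix_outside[OF assms] by (auto simp: fun_eq_iff)

lemma omult_add_left: "omult P (A + B) C = omult P A C + omult P B C"
  by (intro ext) (simp add: omult_def sum.distrib)

lemma omult_add_right:
  assumes A: "is_opmatrix P A" and B: "is_opmatrix P B" and C: "is_opmatrix P C"
  shows "omult P A (B + C) = omult P A B + omult P A C"
proof -
  have "A p s (B s q h + C s q h) = A p s (B s q h) + A p s (C s q h)"
    if s: "s \<in> indices P" for p q s h
  proof -
    have "B s q h \<in> comp_space P s" "C s q h \<in> comp_space P s"
      using opmatrix_apply_mem[OF _ s subspace[OF s]] B C by blast+
    then show ?thesis
      using opmatrix_linear[OF A _ s, of p] opmatrix_outside[OF A, of p s]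
      by (cases "p \<in> indices P") (auto simp: linear_into_def)
  qed
  then have "omult P A (B + C) p q h = omult P A B p q h + omult P A C p q h" for p q h
    unfolding omult_def sum.distrib[symmetric] by (intro sum.cong) auto
  then show ?thesis by (intro ext) simp
qed

subsection \<open>Ring notions in terms of operator matrices\<close>

lemma ring_opring: "ring (opring P)"
proof (rule ringI)
  show "abelian_group (opring P)"
  proof (rule abelian_groupI)
    show "\<exists>Y\<in>carrier (opring P). Y \<oplus>\<^bsub>opring P\<^esub> X = \<zero>\<^bsub>opring P\<^esub>" if "X \<in> carrier (opring P)" for X
      using that is_opmatrix_uminus by (intro bexI[of _ "- X"]) auto
  qed (auto simp: is_opmatrix_add is_opmatrix_zero add_ac)
  show "monoid (opring P)"
    by (rule monoidI)
      (auto simp: is_opmatrix_omult omult_assoc Id_op_omult is_opmatrix_diag_id Id_op_def[symmetric]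
        intro: is_opmatrix_diag_id[OF subset_refl, folded Id_op_def])
qed (auto simp: omult_add_left omult_add_right)

sublocale ops: ring "opring P"
  by (rule ring_opring)

lemma opring_minus:
  assumes "is_opmatrix P A" "is_opmatrix P B"
  shows "A \<ominus>\<^bsub>opring P\<^esub> B = A - B"
proof -
  have "\<ominus>\<^bsub>opring P\<^esub> B = - B"
    using assms is_opmatrix_uminus by (intro ops.minus_equality) auto
  then show ?thesis by (simp add: ops.minus_eq)
qed

lemma opow_eq_nat_pow:
  assumes "is_opmatrix P A"
  shows "opow P A n = A [^]\<^bsub>opring P\<^esub> n"
proof (induction n)
  case (Suc n)
  then show ?case using ops.nat_pow_Suc2[of A n] assms by (simp del: nat_pow_Suc ops.nat_pow_Suc)
qed simp

lemma oinvertible_iff_Units: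
  assumes "is_opmatrix P A"
  shows "oinvertible P A \<longleftrightarrow> A \<in> Units (opring P)"
  using assms by (auto simp: oinvertible_def is_oinverse_def Units_def)

lemma oinv_eq_inv: "oinv P A = inv\<^bsub>opring P\<^esub> A"
  by (simp add: oinv_def is_oinverse_def m_inv_def conj_commute conj_left_commute)

text \<open>
  The \<open>m\<close>-th power of a strictly lower triangular matrix vanishes above the \<open>m\<close>-th subdiagonal, so
  the matrix is nilpotent.
\<close>

lemma one_minus_strictly_lower_Units:
  assumes A: "is_opmatrix P A" and lower: "\<And>p q. p \<le> q \<Longrightarrow> A p q = 0"
  shows "Id_op P - A \<in> Units (opring P)"
proof -
  have band: "(A [^]\<^bsub>opring P\<^esub> m) p q = 0" if "p < q + m" for m p q
    using that
  proof (induction m arbitrary: p)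
    case 0
    then show ?case by (simp add: Id_op_def diag_id_def)
  next
    case (Suc m)
    have Am: "is_opmatrix P (A [^]\<^bsub>opring P\<^esub> m)" using ops.nat_pow_closed[of A m] A by simp
    have "A p s ((A [^]\<^bsub>opring P\<^esub> m) s q h) = 0" if s: "s \<in> indices P" for s h
    proof (cases "p \<le> s")
      case False
      then have "(A [^]\<^bsub>opring P\<^esub> m) s q = 0" using Suc.prems by (intro Suc.IH) simp
      then have "(A [^]\<^bsub>opring P\<^esub> m) s q h = 0" by (simp add: zero_fun_def)
      then show ?thesis using opmatrix_apply_sum[OF A s, of "{}" undefined p] by simp
    qed (simp add: lower)
    then have "omult P A (A [^]\<^bsub>opring P\<^esub> m) p q = 0"
      by (intro ext) (simp add: omult_def)
    then show ?case
      using ops.nat_pow_Suc2[of A m] A by (simp del: nat_pow_Suc ops.nat_pow_Suc)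
  qed
  \<comment> \<open>Any exponent not below the size \<open>2 * nstrips P - 2\<close> serves.\<close>
  have "A [^]\<^bsub>opring P\<^esub> (2 * nstrips P) = 0"
  proof (intro ext)
    fix p q h x
    have "is_opmatrix P (A [^]\<^bsub>opring P\<^esub> (2 * nstrips P))"
      using ops.nat_pow_closed[of A "2 * nstrips P"] A by simp
    then show "(A [^]\<^bsub>opring P\<^esub> (2 * nstrips P)) p q h x = (0 :: opmatrix) p q h x"
      using band[of p q "2 * nstrips P"] opmatrix_outside[of P _ p q]
      by (cases "p \<in> indices P") (auto simp: indices_def)
  qed
  then have "\<one>\<^bsub>opring P\<^esub> \<ominus>\<^bsub>opring P\<^esub> A \<in> Units (opring P)"
    using A by (intro ops.one_minus_nilpotent_Units) auto
  then show ?thesis using opring_minus A is_opmatrix_diag_id[of "indices P"] by (simp add: Id_op_def)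
qed

end

section \<open>The Block Jacobi error propagation\<close>

text \<open>
  Among left interfaces, information travels only from strip \<open>i\<close> to strip \<open>i + 1\<close>, among right
  interfaces only from strip \<open>i\<close> to strip \<open>i - 1\<close>.  The left-right numbering counts the right
  interfaces backwards, so in both cases the index increases by one.
\<close>

lemma T_LR_lower_in_blocks:
  assumes "p \<le> q" and "q < nstrips P \<or> nstrips P \<le> p"
  shows "T_LR P p q = 0"
  using assms by (auto simp: T_LR_def T_entry_def lr_def indices_def)

theorem proposition4p3:
  fixes P :: helmholtz_dd
  assumes "strip_decomposition P"
  shows "oinvertible P (Id_op P - M_r P) \<and> oinvertible P (Id_op P - M_l P) \<and>
    oinvertible P (M_BJ P) \<and>
    T_LR P = M_l P + A_l P + M_r P + A_r P \<and>
    R_BJ P = C_r P + C_l P \<and>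
    (\<forall>n::nat. n > 0 \<and> even n \<longrightarrow>
       opow P (R_BJ P) n =
         opow P (omult P (C_r P) (C_l P)) (n div 2) + opow P (omult P (C_l P) (C_r P)) (n div 2))"
proof -
  interpret component_subspaces P
    using subspace_comp_space[OF assms] by unfold_locales
  let ?L = "{1..nstrips P - 1}" and ?R = "{nstrips P..2 * nstrips P - 2}"
  have N: "nstrips P \<ge> 2" using assms by (simp add: strip_decomposition_def strip_geometry_def)
  then have sub: "?L \<subseteq> indices P" "?R \<subseteq> indices P" and split: "indices P = ?L \<union> ?R" "?L \<inter> ?R = {}"
    by (auto simp: indices_def)
  have T: "is_opmatrix P (T_LR P)" by (rule T_LR_is_opmatrix[OF assms])
  have I: "is_opmatrix P (I_l P)" "is_opmatrix P (I_r P)" "is_opmatrix P (Id_op P)"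
    unfolding I_l_def I_r_def Id_op_def by (intro is_opmatrix_diag_id sub order_refl)+
  have tr: "otranspose (I_l P) = I_l P" "otranspose (I_r P) = I_r P"
    by (auto simp: otranspose_def I_l_def I_r_def diag_id_def fun_eq_iff)
  have orth: "omult P (I_l P) (I_r P) = 0" "omult P (I_r P) (I_l P) = 0"
    using split(2)
    unfolding I_l_def I_r_def omult_diag_id_left[OF is_opmatrix_diag_id[OF sub(2)] sub(1)]
      omult_diag_id_left[OF is_opmatrix_diag_id[OF sub(1)] sub(2)]
    by (auto simp: diag_id_def fun_eq_iff)
  note blocks = M_l_def[of P, unfolded tr] A_l_def[of P, unfolded tr]
    A_r_def[of P, unfolded tr] M_r_def[of P, unfolded tr]
  have entries:
    "M_l P = (\<lambda>p q. if p \<in> ?L \<and> q \<in> ?L then T_LR P p q else 0)"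
    "A_l P = (\<lambda>p q. if p \<in> ?L \<and> q \<in> ?R then T_LR P p q else 0)"
    "A_r P = (\<lambda>p q. if p \<in> ?R \<and> q \<in> ?L then T_LR P p q else 0)"
    "M_r P = (\<lambda>p q. if p \<in> ?R \<and> q \<in> ?R then T_LR P p q else 0)"
    unfolding blocks I_l_def I_r_def
    by (simp_all only: omult_diag_id_both[OF T] sub)
  have blk: "is_opmatrix P (M_l P)" "is_opmatrix P (A_l P)" "is_opmatrix P (A_r P)" "is_opmatrix P (M_r P)"
    unfolding blocks using T I by (simp_all add: is_opmatrix_omult)
  have sum: "T_LR P = M_l P + A_l P + M_r P + A_r P"
    using opmatrix_outside[OF T] split unfolding entries by (auto simp: fun_eq_iff)
  have lower: "M_l P p q = 0" "M_r P p q = 0" "(M_r P + M_l P) p q = 0" if "p \<le> q" for p q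
    using T_LR_lower_in_blocks[OF that, of P] N unfolding entries by fastforce+
  \<comment> \<open>\<open>M_BJ\<close> is itself the identity minus one strictly lower triangular matrix, as the two
    diagonal blocks do not overlap.\<close>
  have BJ: "M_BJ P = Id_op P - (M_r P + M_l P)" by (simp add: M_BJ_def algebra_simps)
  have U: "Id_op P - M_r P \<in> Units (opring P)" "Id_op P - M_l P \<in> Units (opring P)"
    "M_BJ P \<in> Units (opring P)"
    unfolding BJ by (intro one_minus_strictly_lower_Units blk is_opmatrix_add lower; assumption)+
  have m: "Id_op P \<ominus>\<^bsub>opring P\<^esub> M_l P = Id_op P - M_l P" "Id_op P \<ominus>\<^bsub>opring P\<^esub> M_r P = Id_op P - M_r P"
    "(Id_op P - M_r P) \<ominus>\<^bsub>opring P\<^esub> M_l P = M_BJ P"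
    using opring_minus I blk ops.Units_closed[OF U(1)] by (simp_all add: M_BJ_def)
  have C: "C_l P = omult P (inv\<^bsub>opring P\<^esub> (Id_op P - M_l P)) (A_l P)"
    "C_r P = omult P (inv\<^bsub>opring P\<^esub> (Id_op P - M_r P)) (A_r P)"
    by (simp_all add: C_l_def C_r_def oinv_eq_inv)
  have CC: "is_opmatrix P (C_l P)" "is_opmatrix P (C_r P)"
    unfolding C using U ops.Units_inv_closed blk by (auto intro: is_opmatrix_omult)
  have main: "omult P (M_BJ P) (C_r P + C_l P) = A_l P + A_r P"
    "omult P (C_l P) (C_l P) = 0" "omult P (C_r P) (C_r P) = 0"
    using ops.block_jacobi_error[of "I_l P" "I_r P" "T_LR P" "M_l P" "A_l P" "A_r P" "M_r P" "C_l P" "C_r P"]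
      I T orth blocks U C m by simp_all
  \<comment> \<open>The diagonal blocks cancel, and the coupling blocks that remain equal \<open>M_BJ (C_r + C_l)\<close>.\<close>
  have "M_BJ P - (Id_op P - T_LR P) = A_l P + A_r P"
    unfolding M_BJ_def sum by (simp add: algebra_simps)
  then have "R_BJ P = omult P (inv\<^bsub>opring P\<^esub> (M_BJ P)) (omult P (M_BJ P) (C_r P + C_l P))"
    by (simp add: R_BJ_def error_propagation_def oinv_eq_inv main)
  also have "\<dots> = C_r P + C_l P"
    using omult_assoc[of "inv\<^bsub>opring P\<^esub> (M_BJ P)" "M_BJ P" "C_r P + C_l P"]
      ops.Units_l_inv[OF U(3)] ops.Units_closed[OF U(3)] ops.Units_inv_closed[OF U(3)] CC
    by (simp add: is_opmatrix_add Id_op_omult)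
  finally have R: "R_BJ P = C_r P + C_l P" .
  have "opow P (R_BJ P) n =
         opow P (omult P (C_r P) (C_l P)) (n div 2) + opow P (omult P (C_l P) (C_r P)) (n div 2)"
    if "n > 0" "even n" for n
    using ops.even_power_add_of_square_zero[of "C_r P" "C_l P" n] that CC main(2,3)
    by (simp add: R opow_eq_nat_pow is_opmatrix_add is_opmatrix_omult)
  then show ?thesis
    using U R sum ops.Units_closed by (simp add: oinvertible_iff_Units)
qed

end
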